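(* Let $U,V,W$ be (finite- or infinite-dimensional) Hilbert spaces with orthonormal bases $u_i$, $v_j$, $w_k$, let $h=\sum_{i,j,k}h_{ijk}\,u_i\otimes v_j\otimes w_k\in U\otimes V\otimes W$ be a unit vector, let $\nu_h$ be the associated unitary representation of $\mathbb G=\mathbb G^{[3]}$ in $\mathbf H=(U\otimes V\otimes W,h)\otimes(U\otimes V\otimes W,h)\otimes\cdots$, and let $\xi=h\otimes h\otimes\cdots$. Let $\Phi_h(\mathbf g)=\langle\nu_h(\mathbf g)\xi,\xi\rangle$, regarded as a function on $K\backslash\mathbb G/K$, i.e. on the set of non-labeled checker-boards. Then for every non-labeled checker-board $\mathfrak a$, $$\Phi_h(\mathfrak a)=\sum\ \prod_{\text{black triangles }T}h_{i(T)j(T)k(T)}\prod_{\text{white triangles }S}\overline{h_{i(S)j(S)k(S)}},$$ where the sum is over all arrangements of basis indices on the edges of $\mathfrak a$, in which each red edge gets an index $i$ of the basis of $U$, each yellow edge an index $j$ of the basis of $V$, and each blue edge an index $k$ of the basis of $W$, and $i(T),j(T),k(T)$ denote the indices on the red, yellow and blue sides of a triangle $T$.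
   Context: Group. $S_\infty$ is the group of all permutations of $\mathbb N=\{1,2,\dots\}$; $S_\infty^{fin}$ is the subgroup of finitely supported permutations. $\mathbb G=\mathbb G^{[3]}$ is the group of triples $(g_1,g_2,g_3)=(g_{red},g_{yellow},g_{blue})\in S_\infty^3$ such that $g_ig_j^{-1}\in S_\infty^{fin}$ for all $i,j$. $K\subset\mathbb G$ is the diagonal copy of $S_\infty$. Representation $\nu_h$. Put $H=U\otimes V\otimes W$. $\mathbf H=(H,h)\otimes(H,h)\otimes\cdots$ is von Neumann's infinite tensor product with distinguished unit vector $h$ (the Hilbert completion of the inductive limit of $H^{\otimes N}$ under the isometric embeddings $x\mapsto x\otimes h$), and $\xi=h\otimes h\otimes\cdots$. In $\nu_h$, an element $(g_1,g_2,g_3)$ with all $g_i\in S_\infty^{fin}$ acts by permuting the factors $U$ by $g_1$, the factors $V$ by $g_2$, and the factors $W$ by $g_3$ (the factor in position $m$ is moved to position $g(m)$); an element $(r,r,r)\in K$ acts by the simultaneous permutation of the factors $H$ by $r$ and fixes $\xi$. These operators generate a unitary representation $\nu_h$ of $\mathbb G$. Since $\xi$ is $K$-fixed, $\Phi_h$ is a function on $K\backslash\mathbb G/K$. Non-labeled checker-boards. To $\mathbf g\in\mathbb G$ associate black triangles $A_i$ (sides colored red, yellow, blue anticlockwise) and white triangles $B_i$ (sides colored red, yellow, blue clockwise), $i\in\mathbb N$, and for each color $c$ and each $i$ glue the $c$-edge of $A_i$ to the $c$-edge of $B_{g_c(i)}$. All but finitely many components of the resulting surface are chebureks, i.e. consist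 of one black and one white triangle glued along all three sides of the same colors. Forgetting the numbers on triangles and deleting all chebureks gives a compact (possibly disconnected or empty) triangulated surface with colored triangles and edges, the non-labeled checker-board of $\mathbf g$; this identifies $K\backslash\mathbb G/K$ with the set of isomorphism classes of non-labeled checker-boards. *)

theory Defs
  imports "HOL-Analysis.Analysis"
begin

section \<open>Complex Hilbert spaces\<close>

text \<open>
  A complex Hilbert space is a complete real inner product space with a complex scalar
  multiplication and a sesquilinear form extending the real structure.  The form is linear in the
  first and antilinear in the second argument; norm and topology are the library ones, and
  positivity of \<open>cinner\<close> follows from that of \<open>inner\<close>.
\<close>

class complex_hilbert_space = real_inner + complete_space +
  fixes scaleC :: "complex \<Rightarrow> 'a \<Rightarrow> 'a"  (infixr "*\<^sub>C" 75)
    and cinner :: "'a \<Rightarrow> 'a \<Rightarrow> complex"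
  assumes scaleC_add_right: "a *\<^sub>C (x + y) = a *\<^sub>C x + a *\<^sub>C y"
    and scaleC_add_left: "(a + b) *\<^sub>C x = a *\<^sub>C x + b *\<^sub>C x"
    and scaleC_scaleC: "a *\<^sub>C b *\<^sub>C x = (a * b) *\<^sub>C x"
    and scaleC_one: "1 *\<^sub>C x = x"
    and scaleR_scaleC: "r *\<^sub>R x = complex_of_real r *\<^sub>C x"
    and cinner_commute: "cinner x y = cnj (cinner y x)"
    and cinner_add_left: "cinner (x + y) z = cinner x z + cinner y z"
    and cinner_scaleC_left: "cinner (a *\<^sub>C x) y = a * cinner x y"
    and Re_cinner: "Re (cinner x y) = inner x y"

global_interpretation complex_vector:
  vector_space "scaleC :: complex \<Rightarrow> 'a \<Rightarrow> 'a :: complex_hilbert_space"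
  by unfold_locales (simp_all add: scaleC_add_right scaleC_add_left scaleC_scaleC scaleC_one)

abbreviation cspan :: "'a :: complex_hilbert_space set \<Rightarrow> 'a set" where
  "cspan \<equiv> module.span scaleC"

abbreviation clinear :: "('a :: complex_hilbert_space \<Rightarrow> 'b :: complex_hilbert_space) \<Rightarrow> bool" where
  "clinear \<equiv> Vector_Spaces.linear scaleC scaleC"

text \<open>The index type \<open>'i\<close> is arbitrary, so no restriction is placed on the dimension.\<close>

definition orthonormal_basis :: "('i \<Rightarrow> 'a :: complex_hilbert_space) \<Rightarrow> bool" where
  "orthonormal_basis u \<longleftrightarrow>
     (\<forall>i j. cinner (u i) (u j) = (if i = j then 1 else 0)) \<and>
     closure (cspan (range u)) = UNIV"

definition unitary :: "('a :: complex_hilbert_space \<Rightarrow> 'a) \<Rightarrow> bool" where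
  "unitary A \<longleftrightarrow> clinear A \<and> bij A \<and> (\<forall>x y. cinner (A x) (A y) = cinner x y)"


section \<open>Tensor products\<close>

text \<open>
  Hilbert tensor products are completions and hence only determined up to a canonical unitary
  isomorphism.  \<open>hilbert_tensor tens\<close> states that the Hilbert space \<open>'h\<close>, with elementary tensors
  \<open>tens x y z\<close>, is the completion of the algebraic tensor product of \<open>'u\<close>, \<open>'v\<close> and \<open>'w\<close> with
  respect to its usual inner product.
\<close>

definition hilbert_tensor ::
  "('u :: complex_hilbert_space \<Rightarrow> 'v :: complex_hilbert_space \<Rightarrow> 'w :: complex_hilbert_space
     \<Rightarrow> 'h :: complex_hilbert_space) \<Rightarrow> bool" where
  "hilbert_tensor tens \<longleftrightarrow>
     (\<forall>y z. clinear (\<lambda>x. tens x y z)) \<and>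
     (\<forall>x z. clinear (\<lambda>y. tens x y z)) \<and>
     (\<forall>x y. clinear (\<lambda>z. tens x y z)) \<and>
     (\<forall>x y z x' y' z'. cinner (tens x y z) (tens x' y' z') =
        cinner x x' * cinner y y' * cinner z z') \<and>
     closure (cspan {tens x y z | x y z. True}) = UNIV"

text \<open>The sequence \<open>x 0, \<dots>, x (N - 1), h, h, \<dots>\<close>.\<close>

definition pad :: "'h \<Rightarrow> nat \<Rightarrow> (nat \<Rightarrow> 'h) \<Rightarrow> nat \<Rightarrow> 'h" where
  "pad h N x = (\<lambda>n. if n < N then x n else h)"

text \<open>
  The infinite tensor product of copies of \<open>('h, h)\<close>.  The first two clauses say that
  \<open>x \<mapsto> T (pad h N x)\<close> is the multilinear map to elementary tensors of a copy of the \<open>N\<close>-th tensor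
  power of \<open>'h\<close> inside \<open>'H\<close>.  As padding a sequence whose \<open>N\<close>-th entry is \<open>h\<close> at stage \<open>N\<close> or at
  stage \<open>Suc N\<close> gives the same sequence, the isometric embedding of stage \<open>N\<close> into stage \<open>Suc N\<close>
  is \<open>x \<mapsto> x \<otimes> h\<close>.  The last clause says that \<open>'H\<close> is the completion of the union of all stages.
  Only the values of \<open>T\<close> on sequences that are eventually \<open>h\<close> matter.  Positions are counted
  from \<open>0\<close>.
\<close>

definition infinite_tensor ::
  "'h :: complex_hilbert_space \<Rightarrow> ((nat \<Rightarrow> 'h) \<Rightarrow> 'H :: complex_hilbert_space) \<Rightarrow> bool" where
  "infinite_tensor h T \<longleftrightarrow>
     (\<forall>N x. \<forall>n<N. clinear (\<lambda>y. T (pad h N (x(n := y))))) \<and>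
     (\<forall>N x y. cinner (T (pad h N x)) (T (pad h N y)) = (\<Prod>n<N. cinner (x n) (y n))) \<and>
     closure (cspan {T (pad h N x) | N x. True}) = UNIV"


section \<open>The group and the representation\<close>

datatype color = Red | Yellow | Blue

text \<open>Triples of permutations are families indexed by the three colors.\<close>

definition Sym_fin :: "(nat \<Rightarrow> nat) set" where
  "Sym_fin = {p. bij p \<and> finite {n. p n \<noteq> n}}"

definition GG :: "(color \<Rightarrow> nat \<Rightarrow> nat) set" where
  "GG = {g. (\<forall>c. bij (g c)) \<and> (\<forall>c d. g c \<circ> inv (g d) \<in> Sym_fin)}"

definition unitary_representation ::
  "((color \<Rightarrow> nat \<Rightarrow> nat) \<Rightarrow> 'H :: complex_hilbert_space \<Rightarrow> 'H) \<Rightarrow> bool" where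
  "unitary_representation \<nu> \<longleftrightarrow>
     (\<forall>g\<in>GG. unitary (\<nu> g)) \<and>
     (\<forall>g\<in>GG. \<forall>g'\<in>GG. \<nu> (\<lambda>c. g c \<circ> g' c) = \<nu> g \<circ> \<nu> g')"

text \<open>
  Moving the factor in position \<open>m\<close> to position \<open>p m\<close> puts into position \<open>n\<close> the factor that was
  in position \<open>inv p n\<close>.  The vector \<open>h\<close> need not be decomposable, so the action of a finitary
  triple is prescribed on elementary tensors of a stage \<open>N\<close> that contains its support.
  For the constant sequence \<open>h\<close> the third clause says that the diagonal fixes \<open>T (\<lambda>_. h)\<close>.
  The group is generated by the elements occurring in the second and third clause, so \<open>\<nu>\<close> is
  uniquely determined on it.
\<close>

definition tensor_representation ::
  "('u :: complex_hilbert_space \<Rightarrow> 'v :: complex_hilbert_space \<Rightarrow> 'w :: complex_hilbert_space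
     \<Rightarrow> 'h :: complex_hilbert_space)
   \<Rightarrow> 'h \<Rightarrow> ((nat \<Rightarrow> 'h) \<Rightarrow> 'H :: complex_hilbert_space)
   \<Rightarrow> ((color \<Rightarrow> nat \<Rightarrow> nat) \<Rightarrow> 'H \<Rightarrow> 'H) \<Rightarrow> bool" where
  "tensor_representation tens h T \<nu> \<longleftrightarrow>
     unitary_representation \<nu> \<and>
     (\<forall>g N x y z. (\<forall>c. bij (g c)) \<and> (\<forall>c. \<forall>n\<ge>N. g c n = n) \<longrightarrow>
        \<nu> g (T (pad h N (\<lambda>n. tens (x n) (y n) (z n)))) =
        T (pad h N (\<lambda>n. tens (x (inv (g Red) n)) (y (inv (g Yellow) n)) (z (inv (g Blue) n))))) \<and>
     (\<forall>r N x. bij r \<longrightarrow> \<nu> (\<lambda>_. r) (T (pad h N x)) = T (pad h N x \<circ> inv r))"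

definition spherical ::
  "'h \<Rightarrow> ((nat \<Rightarrow> 'h) \<Rightarrow> 'H :: complex_hilbert_space)
   \<Rightarrow> ((color \<Rightarrow> nat \<Rightarrow> nat) \<Rightarrow> 'H \<Rightarrow> 'H) \<Rightarrow> (color \<Rightarrow> nat \<Rightarrow> nat) \<Rightarrow> complex" where
  "spherical h T \<nu> g = cinner (\<nu> g (T (\<lambda>_. h))) (T (\<lambda>_. h))"


section \<open>Checker-boards\<close>

text \<open>
  A surface glued from black and white triangles is given by its triangles, its colored edges, and
  the edge lying on each side of each triangle.  The cyclic order of the colors around a
  triangle is determined by whether it is black or white, so a color-preserving isomorphism
  is automatically orientation-preserving.
\<close>

record ('b, 'w, 'e) board =
  black :: "'b set"
  white :: "'w set"
  edges :: "'e set"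
  edge_color :: "'e \<Rightarrow> color"
  bside :: "'b \<Rightarrow> color \<Rightarrow> 'e"
  wside :: "'w \<Rightarrow> color \<Rightarrow> 'e"

definition edges_of :: "('b, 'w, 'e) board \<Rightarrow> color \<Rightarrow> 'e set" where
  "edges_of X c = {e \<in> edges X. edge_color X e = c}"

text \<open>Every edge lies on exactly one black and exactly one white triangle.\<close>

definition is_board :: "('b, 'w, 'e) board \<Rightarrow> bool" where
  "is_board X \<longleftrightarrow>
     (\<forall>c. bij_betw (\<lambda>A. bside X A c) (black X) (edges_of X c)) \<and>
     (\<forall>c. bij_betw (\<lambda>B. wside X B c) (white X) (edges_of X c))"

definition cheburek :: "('b, 'w, 'e) board \<Rightarrow> 'b \<Rightarrow> 'w \<Rightarrow> bool" where
  "cheburek X A B \<longleftrightarrow> A \<in> black X \<and> B \<in> white X \<and> (\<forall>c. bside X A c = wside X B c)"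

definition is_checkerboard :: "('b, 'w, 'e) board \<Rightarrow> bool" where
  "is_checkerboard X \<longleftrightarrow>
     is_board X \<and> finite (black X) \<and> finite (white X) \<and> (\<nexists>A B. cheburek X A B)"

definition delete_chebureks :: "('b, 'w, 'e) board \<Rightarrow> ('b, 'w, 'e) board" where
  "delete_chebureks X = X
     \<lparr> black := {A \<in> black X. \<nexists>B. cheburek X A B},
       white := {B \<in> white X. \<nexists>A. cheburek X A B},
       edges := {e \<in> edges X. \<nexists>A B c. cheburek X A B \<and> e = bside X A c} \<rparr>"

text \<open>
  The surface of \<open>g\<close>: the black triangles \<open>A\<^sub>i\<close> and the white triangles \<open>B\<^sub>i\<close> are represented by
  their numbers, and \<open>(c, i)\<close> is the edge of color \<open>c\<close> of \<open>A\<^sub>i\<close>, which is glued to the edge of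
  color \<open>c\<close> of the white triangle with number \<open>g c i\<close>.
\<close>

definition labeled_board :: "(color \<Rightarrow> nat \<Rightarrow> nat) \<Rightarrow> (nat, nat, color \<times> nat) board" where
  "labeled_board g =
     \<lparr> black = UNIV, white = UNIV, edges = UNIV, edge_color = fst,
       bside = (\<lambda>i c. (c, i)), wside = (\<lambda>j c. (c, inv (g c) j)) \<rparr>"

definition board_iso :: "('b, 'w, 'e) board \<Rightarrow> ('b2, 'w2, 'e2) board \<Rightarrow> bool" where
  "board_iso X Y \<longleftrightarrow>
     (\<exists>\<beta> \<omega> \<epsilon>. bij_betw \<beta> (black X) (black Y) \<and> bij_betw \<omega> (white X) (white Y) \<and>
        bij_betw \<epsilon> (edges X) (edges Y) \<and>
        (\<forall>e\<in>edges X. edge_color Y (\<epsilon> e) = edge_color X e) \<and>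
        (\<forall>A\<in>black X. \<forall>c. bside Y (\<beta> A) c = \<epsilon> (bside X A c)) \<and>
        (\<forall>B\<in>white X. \<forall>c. wside Y (\<omega> B) c = \<epsilon> (wside X B c)))"

definition has_checkerboard :: "(color \<Rightarrow> nat \<Rightarrow> nat) \<Rightarrow> ('b, 'w, 'e) board \<Rightarrow> bool" where
  "has_checkerboard g X \<longleftrightarrow> board_iso (delete_chebureks (labeled_board g)) X"

text \<open>
  A function on the group that is constant on the double cosets of the diagonal, regarded as a
  function of non-labeled checker-boards.  The description picks out a value only if some group
  element has the checker-board \<open>X\<close> and all such elements have the same value.
\<close>

definition on_boards ::
  "((color \<Rightarrow> nat \<Rightarrow> nat) \<Rightarrow> complex) \<Rightarrow> ('b, 'w, 'e) board \<Rightarrow> complex" where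
  "on_boards F X = (THE z. \<exists>g\<in>GG. has_checkerboard g X \<and> F g = z)"

text \<open>
  An arrangement of basis indices assigns indices to the red, to the yellow and to the blue edges.
  The functions are extensional, so that each arrangement is counted once.
\<close>

definition arrangements ::
  "('b, 'w, 'e) board \<Rightarrow> (('e \<Rightarrow> 'i) \<times> ('e \<Rightarrow> 'j) \<times> ('e \<Rightarrow> 'k)) set" where
  "arrangements X =
     (edges_of X Red \<rightarrow>\<^sub>E UNIV) \<times> (edges_of X Yellow \<rightarrow>\<^sub>E UNIV) \<times> (edges_of X Blue \<rightarrow>\<^sub>E UNIV)"

end

theory Submission
  imports Defs
begin

text \<open>
  Multiplying by the diagonal on both sides does not change \<open>\<Phi>\<^sub>h\<close> and replaces a group element by a
  finitary triple whose red component is the identity; its chebureks are then exactly the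
  common fixed points of the triple, and a conjugation moves the other positions to
  \<open>0, \<dots>, N - 1\<close>.  In the first \<open>N\<close> factors of \<open>\<xi>\<close>, expand \<open>h\<close> in the basis
  \<open>u\<^sub>i \<otimes> v\<^sub>j \<otimes> w\<^sub>k\<close>.  The finitary triple permutes the elementary tensors of this expansion, so
  the matrix element becomes a sum over all assignments of indices to the \<open>N\<close> positions, that is,
  to the edges of the black triangles; the conjugated coefficients are evaluated at the permuted
  indices, which are those on the edges of the white triangles.
\<close>

section \<open>Orthonormal expansions\<close>

lemma cinner_add_right: "cinner x (y + z) = cinner x y + cinner x (z :: 'a :: complex_hilbert_space)"
  by (metis cinner_add_left cinner_commute complex_cnj_add)

lemma cinner_scaleC_right: "cinner x (a *\<^sub>C y) = cnj a * cinner x (y :: 'a :: complex_hilbert_space)"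
  by (metis cinner_commute cinner_scaleC_left complex_cnj_mult)

lemma cinner_self: "cinner x x = complex_of_real ((norm x)\<^sup>2)"
  for x :: "'a :: complex_hilbert_space"
proof (rule complex_eqI)
  show "Re (cinner x x) = Re (complex_of_real ((norm x)\<^sup>2))"
    by (simp add: Re_cinner power2_norm_eq_inner)
  show "Im (cinner x x) = Im (complex_of_real ((norm x)\<^sup>2))"
    using arg_cong[OF cinner_commute[of x x], of Im] by simp
qed

text \<open>Antilinearity turns the factor \<open>\<i>\<close> in the second argument into
  \<open>- \<i>\<close>, so the real part of \<open>cinner x (\<i> *\<^sub>C y)\<close> is the
  imaginary part of \<open>cinner x y\<close>. Continuity of \<open>cinner\<close> thereby follows
  from that of \<open>inner\<close>.\<close>

lemma cinner_eq_inner: "cinner x y = complex_of_real (inner x y) + \<i> * complex_of_real (inner x (\<i> *\<^sub>C y))"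
  for x y :: "'a :: complex_hilbert_space"
  by (rule complex_eqI) (simp_all add: Re_cinner flip: Re_cinner[of x "\<i> *\<^sub>C y"] add: cinner_scaleC_right)

lemma bounded_linear_cinner_left: "bounded_linear (\<lambda>x. cinner x (y :: 'a :: complex_hilbert_space))"
  unfolding cinner_eq_inner
  by (intro bounded_linear_add bounded_linear_const_mult bounded_linear_compose[OF bounded_linear_of_real]
      bounded_linear_inner_left)

lemma cinner_diff_left: "cinner (x - y) z = cinner x z - cinner y (z :: 'a :: complex_hilbert_space)"
  by (rule linear_diff[OF bounded_linear.linear[OF bounded_linear_cinner_left]])

lemma cinner_diff_right: "cinner x (y - z) = cinner x y - cinner x (z :: 'a :: complex_hilbert_space)"
  by (metis cinner_diff_left cinner_commute complex_cnj_diff)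

lemma cinner_sum_left: "cinner (sum f A) y = (\<Sum>x\<in>A. cinner (f x) (y :: 'a :: complex_hilbert_space))"
  by (rule linear_sum[OF bounded_linear.linear[OF bounded_linear_cinner_left]])

text \<open>Norms are determined by \<open>cinner\<close>, hence preserved. Boundedness lets a
  unitary operator be applied to a convergent series term by term.\<close>

lemma bounded_linear_unitary:
  assumes "unitary A"
  shows "bounded_linear A"
proof -
  interpret A: Vector_Spaces.linear scaleC scaleC A
    using assms by (simp add: unitary_def)
  have "norm (A x) = norm x" for x
  proof -
    have "complex_of_real ((norm (A x))\<^sup>2) = complex_of_real ((norm x)\<^sup>2)"
      unfolding cinner_self[symmetric] using assms by (simp add: unitary_def)
    then show ?thesis
      by (simp only: of_real_eq_iff power2_eq_iff_nonneg norm_ge_zero)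
  qed
  then show ?thesis
    by (intro bounded_linear_intro[of _ 1]) (simp_all add: A.add A.scale scaleR_scaleC)
qed

section \<open>Orthonormal families and Parseval's identity\<close>

definition orthonormal_on :: "'x set \<Rightarrow> ('x \<Rightarrow> 'a :: complex_hilbert_space) \<Rightarrow> bool" where
  "orthonormal_on A e \<longleftrightarrow> (\<forall>x\<in>A. \<forall>y\<in>A. cinner (e x) (e y) = (if x = y then 1 else 0))"

lemma orthonormal_coefficient:
  assumes "orthonormal_on A e" and "((\<lambda>x. c x *\<^sub>C e x) has_sum z) A" and "y \<in> A"
  shows "cinner z (e y) = c y"
proof -
  have "((\<lambda>x. cinner (c x *\<^sub>C e x) (e y)) has_sum cinner z (e y)) A"
    by (rule has_sum_bounded_linear[OF bounded_linear_cinner_left assms(2)])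
  moreover have "((\<lambda>x. cinner (c x *\<^sub>C e x) (e y)) has_sum c y) A"
    using assms(1,3)
    by (intro has_sum_finite_neutralI[of "{y}"]) (auto simp: orthonormal_on_def cinner_scaleC_left)
  ultimately show ?thesis
    by (rule has_sum_unique)
qed

text \<open>Pair the series for \<open>z\<close> with \<open>z\<close> itself: by
  \<open>orthonormal_coefficient\<close> the term at \<open>x\<close> contributes
  \<open>c x * cnj (c x)\<close>.\<close>

lemma parseval:
  assumes "orthonormal_on A e" and "((\<lambda>x. c x *\<^sub>C e x) has_sum z) A"
  shows "((\<lambda>x. (cmod (c x))\<^sup>2) has_sum (norm z)\<^sup>2) A"
proof -
  have "((\<lambda>x. Re (cinner (c x *\<^sub>C e x) z)) has_sum Re (cinner z z)) A"
    by (intro has_sum_bounded_linear[OF bounded_linear_Re]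
        has_sum_bounded_linear[OF bounded_linear_cinner_left assms(2)])
  moreover have "Re (cinner (c x *\<^sub>C e x) z) = (cmod (c x))\<^sup>2" if "x \<in> A" for x
  proof -
    have "cinner (c x *\<^sub>C e x) z = c x * cnj (c x)"
      using orthonormal_coefficient[OF assms that] cinner_commute[of "e x" z]
      by (simp add: cinner_scaleC_left)
    then show ?thesis
      by (simp add: complex_norm_square[symmetric] del: of_real_power)
  qed
  moreover have "Re (cinner z z) = (norm z)\<^sup>2"
    by (simp add: cinner_self)
  ultimately show ?thesis
    by (subst (asm) has_sum_cong) auto
qed

text \<open>A converse of Parseval's identity: the squared distance from \<open>z\<close> to a
  partial sum equals \<open>(norm z)\<^sup>2\<close> minus the partial sum of squared coefficients,
  which tends to \<open>0\<close>.\<close>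

lemma orthonormal_expansion:
  assumes "orthonormal_on A e"
    and "((\<lambda>x. (cmod (cinner z (e x)))\<^sup>2) has_sum (norm z)\<^sup>2) A"
  shows "((\<lambda>x. cinner z (e x) *\<^sub>C e x) has_sum z) A"
proof -
  define s where "s F = (\<Sum>x\<in>F. cinner z (e x) *\<^sub>C e x)" for F
  define q where "q F = (\<Sum>x\<in>F. (cmod (cinner z (e x)))\<^sup>2)" for F
  have eq: "(norm (s F - z))\<^sup>2 = (norm z)\<^sup>2 - q F" if "finite F" "F \<subseteq> A" for F
  proof -
    have s_e: "cinner (s F) (e x) = cinner z (e x)" if "x \<in> F" for x
    proof -
      have "cinner (s F) (e x) = (\<Sum>y\<in>F. if y = x then cinner z (e y) else 0)"
        unfolding s_def cinner_sum_left
        using assms(1) \<open>F \<subseteq> A\<close> that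
        by (intro sum.cong) (auto simp: cinner_scaleC_left orthonormal_on_def subset_iff)
      then show ?thesis
        using \<open>finite F\<close> that by simp
    qed
    \<comment> \<open>The partial sum is the orthogonal projection of \<open>z\<close> onto the span
      of the chosen vectors, so Pythagoras applies.\<close>
    have "cinner (s F) (z - s F) = 0"
    proof -
      have "cinner (e x) (z - s F) = 0" if "x \<in> F" for x
        using s_e[OF that] cinner_commute[of "e x" "z - s F"] by (simp add: cinner_diff_left)
      then show ?thesis
        by (subst (1) s_def) (simp add: cinner_sum_left cinner_scaleC_left)
    qed
    moreover have s_z: "cinner (s F) z = complex_of_real (q F)"
      unfolding s_def q_def cinner_sum_left of_real_sum
      by (intro sum.cong refl)
        (simp only: cinner_scaleC_left cinner_commute[of "e _" z] complex_norm_square)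
    moreover have "cinner z (s F) = complex_of_real (q F)"
      using s_z cinner_commute[of z "s F"] by simp
    ultimately have "cinner (z - s F) (z - s F) = complex_of_real ((norm z)\<^sup>2 - q F)"
      by (subst cinner_diff_left) (simp add: cinner_diff_right cinner_self)
    then show ?thesis
      unfolding cinner_self of_real_eq_iff by (simp add: norm_minus_commute)
  qed
  have "((\<lambda>F. (norm z)\<^sup>2 - q F) \<longlongrightarrow> (norm z)\<^sup>2 - (norm z)\<^sup>2) (finite_subsets_at_top A)"
    using assms(2) unfolding has_sum_def q_def by (intro tendsto_diff tendsto_const)
  then have "((\<lambda>F. (norm (s F - z))\<^sup>2) \<longlongrightarrow> (norm z)\<^sup>2 - (norm z)\<^sup>2) (finite_subsets_at_top A)"
    by (rule Lim_transform_eventually) (simp_all add: eq eventually_finite_subsets_at_top_weakI)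
  then have "((\<lambda>F. sqrt ((norm (s F - z))\<^sup>2)) \<longlongrightarrow> sqrt 0) (finite_subsets_at_top A)"
    by (intro tendsto_real_sqrt) simp
  then have "(s \<longlongrightarrow> z) (finite_subsets_at_top A)"
    by (intro LIM_zero_cancel[of s] tendsto_norm_zero_cancel[of "\<lambda>F. s F - z"]) simp
  then show ?thesis
    unfolding has_sum_def s_def .
qed

text \<open>Finite powers of a probability distribution have total mass one. The distribution used
  later is \<open>(cmod (coord p))\<^sup>2\<close>.\<close>

lemma has_sum_prod_PiE_one:
  fixes f :: "'x \<Rightarrow> real"
  assumes "finite A" and "\<And>x. f x \<ge> 0" and "(f has_sum 1) UNIV"
  shows "((\<lambda>g. \<Prod>n\<in>A. f (g n)) has_sum 1) (A \<rightarrow>\<^sub>E UNIV)"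
proof -
  have "infsum (\<lambda>g. \<Prod>n\<in>A. f (g n)) (A \<rightarrow>\<^sub>E UNIV) = (\<Prod>n\<in>A. infsum f UNIV)"
    using assms by (intro infsum_prod_PiE_abs) (auto simp: summable_on_def)
  then have "infsum (\<lambda>g. \<Prod>n\<in>A. f (g n)) (A \<rightarrow>\<^sub>E UNIV) = 1"
    using assms(3) by (simp add: infsumI)
  then show ?thesis
    \<comment> \<open>\<open>infsum\<close> is \<open>0\<close> for families that are not summable.\<close>
    by (metis has_sum_infsum infsum_not_exists zero_neq_one)
qed

section \<open>The spherical function of a finitary triple\<close>

lemma finitary_in_GG:
  assumes "\<And>c. bij (f c)" and "\<And>c n. n \<ge> N \<Longrightarrow> f c n = n"
  shows "f \<in> GG"
proof -
  have "f c \<circ> inv (f d) \<in> Sym_fin" for c d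
  proof -
    have "{n. (f c \<circ> inv (f d)) n \<noteq> n} \<subseteq> {..<N}"
    proof
      fix n assume n: "n \<in> {n. (f c \<circ> inv (f d)) n \<noteq> n}"
      have "inv (f d) n = n" if "n \<ge> N"
        using assms(1)[of d] assms(2)[OF that, of d] by (simp add: bij_is_inj inv_f_eq)
      with n assms(2)[of n c] show "n \<in> {..<N}"
        by force
    qed
    then show ?thesis
      using assms(1) by (auto simp: Sym_fin_def intro: bij_comp bij_imp_bij_inv finite_subset)
  qed
  then show ?thesis
    using assms(1) by (simp add: GG_def)
qed

section \<open>The tensor model and the expansion of the vacuum vector\<close>

locale tensor_model =
  fixes u :: "'i \<Rightarrow> 'u :: complex_hilbert_space"
    and v :: "'j \<Rightarrow> 'v :: complex_hilbert_space"
    and w :: "'k \<Rightarrow> 'w :: complex_hilbert_space"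
    and tens :: "'u \<Rightarrow> 'v \<Rightarrow> 'w \<Rightarrow> 'h :: complex_hilbert_space"
    and h :: 'h
    and coef :: "'i \<Rightarrow> 'j \<Rightarrow> 'k \<Rightarrow> complex"
    and T :: "(nat \<Rightarrow> 'h) \<Rightarrow> 'H :: complex_hilbert_space"
    and \<nu> :: "(color \<Rightarrow> nat \<Rightarrow> nat) \<Rightarrow> 'H \<Rightarrow> 'H"
  assumes u: "orthonormal_basis u" and v: "orthonormal_basis v" and w: "orthonormal_basis w"
    and tens: "hilbert_tensor tens"
    and h_expansion: "((\<lambda>(i, j, k). coef i j k *\<^sub>C tens (u i) (v j) (w k)) has_sum h) UNIV"
    and norm_h: "norm h = 1"
    and T: "infinite_tensor h T"
    and \<nu>: "tensor_representation tens h T \<nu>"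
begin

definition basis_tensor :: "'i \<times> 'j \<times> 'k \<Rightarrow> 'h" where
  "basis_tensor = (\<lambda>(i, j, k). tens (u i) (v j) (w k))"

definition coord :: "'i \<times> 'j \<times> 'k \<Rightarrow> complex" where
  "coord = (\<lambda>(i, j, k). coef i j k)"

text \<open>A product basis vector of the \<open>N\<close>-th tensor power, followed by copies of
  \<open>h\<close>. Only the values of \<open>x\<close> below \<open>N\<close> matter, so the index
  set will be the extensional functions on \<open>{..<N}\<close>.\<close>

definition stage_tensor :: "nat \<Rightarrow> (nat \<Rightarrow> 'i \<times> 'j \<times> 'k) \<Rightarrow> 'H" where
  "stage_tensor N x = T (pad h N (\<lambda>n. basis_tensor (x n)))"

lemma orthonormal_basis_tensor: "orthonormal_on A basis_tensor"
proof -
  have "cinner (tens x y z) (tens x' y' z') = cinner x x' * cinner y y' * cinner z z'" for x y z x' y' z'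
    using tens by (simp add: hilbert_tensor_def)
  then show ?thesis
    using u v w unfolding orthonormal_on_def orthonormal_basis_def basis_tensor_def
    by (intro ballI) (simp add: split_beta prod_eq_iff del: split_paired_All)
qed

lemma coord_expansion: "((\<lambda>p. coord p *\<^sub>C basis_tensor p) has_sum h) UNIV"
  using h_expansion by (simp add: coord_def basis_tensor_def case_prod_unfold)

lemma cinner_h_basis_tensor: "cinner h (basis_tensor p) = coord p"
  by (rule orthonormal_coefficient[OF orthonormal_basis_tensor coord_expansion UNIV_I])

lemma has_sum_coord: "((\<lambda>p. (cmod (coord p))\<^sup>2) has_sum 1) UNIV"
  using parseval[OF orthonormal_basis_tensor coord_expansion] by (simp add: norm_h)

lemma cinner_T: "cinner (T (pad h N x)) (T (pad h N y)) = (\<Prod>n<N. cinner (x n) (y n))"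
  using T by (simp add: infinite_tensor_def)

lemma pad_const: "pad h N (\<lambda>_. h) = (\<lambda>_. h)"
  by (simp add: pad_def)

lemma cinner_vacuum_stage_tensor:
  "cinner (T (\<lambda>_. h)) (stage_tensor N x) = (\<Prod>n<N. coord (x n))"
  using cinner_T[of N "\<lambda>_. h" "\<lambda>n. basis_tensor (x n)"]
  by (simp add: pad_const stage_tensor_def cinner_h_basis_tensor)

lemma norm_vacuum: "norm (T (\<lambda>_. h)) = 1"
proof -
  have "complex_of_real ((norm (T (\<lambda>_. h)))\<^sup>2) = complex_of_real 1"
    \<comment> \<open>At stage \<open>0\<close> the inner product is an empty product.\<close>
    using cinner_T[of 0 "\<lambda>_. h" "\<lambda>_. h"] unfolding cinner_self[symmetric] by (simp add: pad_const)
  then show ?thesis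
    unfolding of_real_eq_iff power2_eq_1_iff using norm_ge_zero[of "T (\<lambda>_. h)"] by linarith
qed

text \<open>Distinct extensional functions differ at some position below \<open>N\<close>, and the
  factor at that position vanishes.\<close>

lemma orthonormal_stage_tensor: "orthonormal_on ({..<N} \<rightarrow>\<^sub>E UNIV) (stage_tensor N)"
  unfolding orthonormal_on_def
proof (intro ballI)
  fix x y :: "nat \<Rightarrow> 'i \<times> 'j \<times> 'k"
  assume x: "x \<in> {..<N} \<rightarrow>\<^sub>E UNIV" and y: "y \<in> {..<N} \<rightarrow>\<^sub>E UNIV"
  have "cinner (stage_tensor N x) (stage_tensor N y) = (\<Prod>n<N. if x n = y n then 1 else 0)"
    using orthonormal_basis_tensor[of UNIV] by (simp only: stage_tensor_def cinner_T orthonormal_on_def UNIV_I ball_UNIV if_True)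
  also have "\<dots> = (if x = y then 1 else 0)"
  proof (cases "x = y")
    case False
    then obtain n where "n < N" "x n \<noteq> y n"
      using PiE_ext[OF x y] by auto
    with False show ?thesis
      by auto
  qed simp
  finally show "cinner (stage_tensor N x) (stage_tensor N y) = (if x = y then 1 else 0)" .
qed

text \<open>
  The expansion is read off from Parseval's identity.  Multiplying out the series for \<open>h\<close> would
  require unconditional summability of a product of vector-valued series.
\<close>

lemma vacuum_expansion:
  "((\<lambda>x. (\<Prod>n<N. coord (x n)) *\<^sub>C stage_tensor N x) has_sum T (\<lambda>_. h)) ({..<N} \<rightarrow>\<^sub>E UNIV)"
proof -
  have "((\<lambda>x. \<Prod>n<N. (cmod (coord (x n)))\<^sup>2) has_sum 1) ({..<N} \<rightarrow>\<^sub>E UNIV)"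
    by (rule has_sum_prod_PiE_one) (simp_all add: has_sum_coord)
  then have "((\<lambda>x. (cmod (cinner (T (\<lambda>_. h)) (stage_tensor N x)))\<^sup>2)
      has_sum (norm (T (\<lambda>_. h)))\<^sup>2) ({..<N} \<rightarrow>\<^sub>E UNIV)"
    by (simp add: norm_vacuum cinner_vacuum_stage_tensor prod_power_distrib flip: prod_norm)
  from orthonormal_expansion[OF orthonormal_stage_tensor this] show ?thesis
    by (simp add: cinner_vacuum_stage_tensor)
qed

lemma unitary_\<nu>: "g \<in> GG \<Longrightarrow> unitary (\<nu> g)"
  using \<nu> by (simp add: tensor_representation_def unitary_representation_def)

text \<open>Apply \<open>\<nu> f\<close> to the vacuum expansion termwise. Each stage tensor goes to
  a stage tensor, whose pairing with the vacuum is a product of conjugated coordinates.\<close>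

lemma has_sum_spherical_finitary:
  assumes "\<And>c. bij (f c)" and "\<And>c n. n \<ge> N \<Longrightarrow> f c n = n"
  shows "((\<lambda>x. (\<Prod>n<N. coord (x n)) *
            (\<Prod>n<N. cnj (coef (fst (x (inv (f Red) n))) (fst (snd (x (inv (f Yellow) n))))
                              (snd (snd (x (inv (f Blue) n)))))))
          has_sum spherical h T \<nu> f) ({..<N} \<rightarrow>\<^sub>E UNIV)"
proof -
  \<comment> \<open>The three components of an index triple travel separately, so position
    \<open>n\<close> may combine indices coming from three different positions.\<close>
  define \<sigma> where "\<sigma> x n = (fst (x (inv (f Red) n)), fst (snd (x (inv (f Yellow) n))),
      snd (snd (x (inv (f Blue) n))))" for x :: "nat \<Rightarrow> 'i \<times> 'j \<times> 'k" and n
  have \<nu>_stage: "\<nu> f (stage_tensor N x) = stage_tensor N (\<sigma> x)" for x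
  proof -
    have "\<forall>g N x y z. (\<forall>c. bij (g c)) \<and> (\<forall>c. \<forall>n\<ge>N. g c n = n) \<longrightarrow>
        \<nu> g (T (pad h N (\<lambda>n. tens (x n) (y n) (z n)))) =
        T (pad h N (\<lambda>n. tens (x (inv (g Red) n)) (y (inv (g Yellow) n)) (z (inv (g Blue) n))))"
      using \<nu> by (simp add: tensor_representation_def)
    from this[rule_format, of f N "\<lambda>n. u (fst (x n))" "\<lambda>n. v (fst (snd (x n)))"
        "\<lambda>n. w (snd (snd (x n)))"] assms
    show ?thesis
      by (simp add: stage_tensor_def basis_tensor_def \<sigma>_def case_prod_unfold)
  qed
  have uni: "unitary (\<nu> f)"
    by (intro unitary_\<nu> finitary_in_GG[OF assms])
  have "((\<lambda>x. cinner (\<nu> f ((\<Prod>n<N. coord (x n)) *\<^sub>C stage_tensor N x)) (T (\<lambda>_. h)))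
      has_sum cinner (\<nu> f (T (\<lambda>_. h))) (T (\<lambda>_. h))) ({..<N} \<rightarrow>\<^sub>E UNIV)"
    by (intro has_sum_bounded_linear[OF bounded_linear_cinner_left]
        has_sum_bounded_linear[OF bounded_linear_unitary[OF uni]] vacuum_expansion)
  moreover have "cinner (\<nu> f (c *\<^sub>C stage_tensor N x)) (T (\<lambda>_. h)) =
      c * (\<Prod>n<N. cnj (coord (\<sigma> x n)))" for c x
  proof -
    have "\<nu> f (c *\<^sub>C stage_tensor N x) = c *\<^sub>C stage_tensor N (\<sigma> x)"
      using uni by (simp add: unitary_def Vector_Spaces.linear_iff \<nu>_stage)
    then show ?thesis
      using cinner_commute[of "stage_tensor N (\<sigma> x)" "T (\<lambda>_. h)"]
      by (simp add: cinner_scaleC_left cinner_vacuum_stage_tensor)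
  qed
  ultimately show ?thesis
    by (simp add: spherical_def \<sigma>_def coord_def)
qed

text \<open>The diagonal fixes the vacuum: \<open>s\<close> is absorbed on the right, and
  \<open>r\<close> is removed by unitarity after being applied to both arguments of
  \<open>cinner\<close>.\<close>

lemma spherical_biinvariant:
  assumes "g \<in> GG" and "bij r" and "bij s"
  shows "spherical h T \<nu> (\<lambda>c. r \<circ> g c \<circ> s) = spherical h T \<nu> g"
proof -
  have diag: "(\<lambda>_. p) \<in> GG" "\<nu> (\<lambda>_. p) (T (\<lambda>_. h)) = T (\<lambda>_. h)" if "bij p" for p
  proof -
    show "(\<lambda>_. p) \<in> GG"
      using that by (simp add: GG_def Sym_fin_def bij_is_surj surj_f_inv_f bij_comp bij_imp_bij_inv)
    have "\<nu> (\<lambda>_. p) (T (pad h 0 (\<lambda>_. h))) = T (pad h 0 (\<lambda>_. h) \<circ> inv p)"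
      using \<nu> that unfolding tensor_representation_def by blast
    then show "\<nu> (\<lambda>_. p) (T (\<lambda>_. h)) = T (\<lambda>_. h)"
      by (simp add: pad_const comp_def)
  qed
  have hom: "\<nu> (\<lambda>c. a c \<circ> b c) = \<nu> a \<circ> \<nu> b" if "a \<in> GG" "b \<in> GG" for a b
    using \<nu> that by (simp add: tensor_representation_def unitary_representation_def)
  have gs: "(\<lambda>c. g c \<circ> s) \<in> GG"
  proof -
    have "(g c \<circ> s) \<circ> inv (g d \<circ> s) = g c \<circ> inv (g d)" for c d
      using assms by (simp add: GG_def o_inv_distrib fun_eq_iff bij_is_surj surj_f_inv_f)
    then show ?thesis
      using assms by (simp add: GG_def bij_comp)
  qed
  have "\<nu> (\<lambda>c. r \<circ> g c \<circ> s) (T (\<lambda>_. h)) = \<nu> (\<lambda>_. r) (\<nu> g (T (\<lambda>_. h)))"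
    using hom[OF diag(1)[OF assms(2)] gs] hom[OF assms(1) diag(1)[OF assms(3)]] diag(2)[OF assms(3)]
    by (simp add: comp_assoc)
  then have "spherical h T \<nu> (\<lambda>c. r \<circ> g c \<circ> s) =
      cinner (\<nu> (\<lambda>_. r) (\<nu> g (T (\<lambda>_. h)))) (\<nu> (\<lambda>_. r) (T (\<lambda>_. h)))"
    by (simp add: spherical_def diag(2)[OF assms(2)])
  then show ?thesis
    using unitary_\<nu>[OF diag(1)[OF assms(2)]] by (simp add: unitary_def spherical_def)
qed

end

section \<open>Numbered checker-boards\<close>

text \<open>
  As in \<open>labeled_board\<close>, the side of color \<open>c\<close> of the black triangle with number \<open>n\<close> is glued to
  the white triangle with number \<open>f c n\<close>.
\<close>

definition numbering ::
  "nat \<Rightarrow> (color \<Rightarrow> nat \<Rightarrow> nat) \<Rightarrow> (nat \<Rightarrow> 'b) \<Rightarrow> (nat \<Rightarrow> 'c) \<Rightarrow> ('b, 'c, 'e) board \<Rightarrow> bool" where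
  "numbering N f b w X \<longleftrightarrow>
     bij_betw b {..<N} (black X) \<and> bij_betw w {..<N} (white X) \<and>
     (\<forall>c. bij (f c)) \<and> (\<forall>c. \<forall>n\<ge>N. f c n = n) \<and>
     (\<forall>c. \<forall>n<N. wside X (w n) c = bside X (b (inv (f c) n)) c)"

section \<open>Translating index assignments on positions into arrangements on edges\<close>

lemma inv_less_of_fixes_ge:
  fixes p :: "nat \<Rightarrow> nat"
  assumes "bij p" and "\<And>n. n \<ge> N \<Longrightarrow> p n = n" and "n < N"
  shows "inv p n < N"
  using assms by (metis bij_inv_eq_iff leI)

text \<open>The maps \<open>p\<close>, \<open>q\<close>, \<open>r\<close> will send a position to
  the red, yellow and blue edge of its black triangle. Three index functions on edges then amount to
  one triple-valued function on positions.\<close>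

lemma bij_betw_restrict_triple:
  fixes p :: "'a \<Rightarrow> 'b" and q :: "'a \<Rightarrow> 'd" and r :: "'a \<Rightarrow> 'f"
  assumes p: "bij_betw p A B" and q: "bij_betw q A C" and r: "bij_betw r A D"
  shows "bij_betw (\<lambda>(i :: 'b \<Rightarrow> 'c, j :: 'd \<Rightarrow> 'e, k :: 'f \<Rightarrow> 'g). \<lambda>n\<in>A. (i (p n), j (q n), k (r n)))
    ((B \<rightarrow>\<^sub>E UNIV) \<times> (C \<rightarrow>\<^sub>E UNIV) \<times> (D \<rightarrow>\<^sub>E UNIV)) (A \<rightarrow>\<^sub>E UNIV)"
proof -
  \<comment> \<open>Outside \<open>B'\<close> both sides are \<open>undefined\<close>, because
    \<open>g\<close> is extensional.\<close>
  have extend: "(\<lambda>e\<in>B'. g (p' (inv_into A p' e))) = g"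
    if p': "bij_betw p' A B'" and g: "g \<in> B' \<rightarrow>\<^sub>E UNIV" for p' B' and g :: "_ \<Rightarrow> 'z"
  proof
    show "(\<lambda>e\<in>B'. g (p' (inv_into A p' e))) e = g e" for e
      using PiE_arb[OF g, of e] bij_betw_inv_into_right[OF p', of e] by (simp add: restrict_def)
  qed
  have inv_in: "inv_into A p' e \<in> A" if "bij_betw p' A B'" "e \<in> B'" for p' B' e
    using bij_betwE[OF bij_betw_inv_into[OF that(1)]] that(2) by blast
  show ?thesis
  proof (rule bij_betw_byWitness[where f' = "\<lambda>x. (\<lambda>e\<in>B. fst (x (inv_into A p e)),
        \<lambda>e\<in>C. fst (snd (x (inv_into A q e))), \<lambda>e\<in>D. snd (snd (x (inv_into A r e))))"],
      goal_cases)
    case 1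
    have *: "(\<lambda>e\<in>B. fst ((\<lambda>n\<in>A. (i (p n), j (q n), k (r n))) (inv_into A p e))) = (\<lambda>e\<in>B. i (p (inv_into A p e)))"
      "(\<lambda>e\<in>C. fst (snd ((\<lambda>n\<in>A. (i (p n), j (q n), k (r n))) (inv_into A q e)))) = (\<lambda>e\<in>C. j (q (inv_into A q e)))"
      "(\<lambda>e\<in>D. snd (snd ((\<lambda>n\<in>A. (i (p n), j (q n), k (r n))) (inv_into A r e)))) = (\<lambda>e\<in>D. k (r (inv_into A r e)))"
      for i j k
      using inv_in[OF p] inv_in[OF q] inv_in[OF r] by (auto simp: fun_eq_iff)
    then show ?case
      by (clarify, unfold prod.case *) (simp add: extend[OF p] extend[OF q] extend[OF r])
  next
    case 2
    have inv: "p' n \<in> B'" "inv_into A p' (p' n) = n" if "bij_betw p' A B'" "n \<in> A" for p' B' n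
      using bij_betwE[OF that(1)] bij_betw_inv_into_left[OF that] that(2) by blast+
    show ?case
    proof (intro ballI ext, unfold prod.case)
      fix x :: "'a \<Rightarrow> 'c \<times> 'e \<times> 'g" and n
      assume x: "x \<in> A \<rightarrow>\<^sub>E UNIV"
      show "(\<lambda>n\<in>A. ((\<lambda>e\<in>B. fst (x (inv_into A p e))) (p n),
          (\<lambda>e\<in>C. fst (snd (x (inv_into A q e)))) (q n),
          (\<lambda>e\<in>D. snd (snd (x (inv_into A r e)))) (r n))) n = x n"
        by (cases "n \<in> A") (simp_all add: inv[OF p] inv[OF q] inv[OF r] PiE_arb[OF x])
    qed
  qed auto
qed

text \<open>Position \<open>n\<close> carries the edges of the black triangle \<open>b n\<close>.
  The side of color \<open>c\<close> of the white triangle \<open>wt n\<close> belongs to position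
  \<open>inv (f c) n\<close>, which is exactly where the conjugated factors of the finitary formula
  are evaluated.\<close>

lemma (in tensor_model) has_sum_spherical_numbering:
  fixes X :: "('b, 'c, 'e) board"
  assumes X: "is_board X" and num: "numbering N f b wt X"
  shows "((\<lambda>(i, j, k).
            (\<Prod>A\<in>black X. coef (i (bside X A Red)) (j (bside X A Yellow)) (k (bside X A Blue))) *
            (\<Prod>B\<in>white X. cnj (coef (i (wside X B Red)) (j (wside X B Yellow)) (k (wside X B Blue)))))
          has_sum spherical h T \<nu> f) (arrangements X)"
proof -
  have b: "bij_betw b {..<N} (black X)" and wt: "bij_betw wt {..<N} (white X)"
    and bij: "\<And>c. bij (f c)" and fixes_ge: "\<And>c n. n \<ge> N \<Longrightarrow> f c n = n"
    and glue: "\<And>c n. n < N \<Longrightarrow> wside X (wt n) c = bside X (b (inv (f c) n)) c"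
    using num by (simp_all add: numbering_def)
  have inv_less: "inv (f c) n < N" if "n < N" for c n
    using inv_less_of_fixes_ge[OF bij fixes_ge that] .
  have side: "bij_betw (\<lambda>n. bside X (b n) c) {..<N} (edges_of X c)" for c
    using X b bij_betw_trans[of b "{..<N}" "black X" "\<lambda>A. bside X A c"]
    by (simp add: is_board_def comp_def)
  define \<Phi> where "\<Phi> = (\<lambda>(i :: 'e \<Rightarrow> 'i, j :: 'e \<Rightarrow> 'j, k :: 'e \<Rightarrow> 'k).
    \<lambda>n\<in>{..<N}. (i (bside X (b n) Red), j (bside X (b n) Yellow), k (bside X (b n) Blue)))"
  have \<Phi>: "bij_betw \<Phi> (arrangements X) ({..<N} \<rightarrow>\<^sub>E UNIV)"
    unfolding \<Phi>_def arrangements_def by (intro bij_betw_restrict_triple side)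
  have black: "(\<Prod>n<N. coord (\<Phi> (i, j, k) n)) =
      (\<Prod>A\<in>black X. coef (i (bside X A Red)) (j (bside X A Yellow)) (k (bside X A Blue)))" for i j k
    by (subst prod.reindex_bij_betw[OF b, symmetric]) (simp add: \<Phi>_def coord_def)
  have white: "(\<Prod>n<N. cnj (coef (fst (\<Phi> (i, j, k) (inv (f Red) n)))
        (fst (snd (\<Phi> (i, j, k) (inv (f Yellow) n)))) (snd (snd (\<Phi> (i, j, k) (inv (f Blue) n)))))) =
      (\<Prod>B\<in>white X. cnj (coef (i (wside X B Red)) (j (wside X B Yellow)) (k (wside X B Blue))))" for i j k
    by (subst prod.reindex_bij_betw[OF wt, symmetric]) (simp add: \<Phi>_def glue inv_less)
  have "((\<lambda>a. (\<Prod>n<N. coord (\<Phi> a n)) *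
            (\<Prod>n<N. cnj (coef (fst (\<Phi> a (inv (f Red) n))) (fst (snd (\<Phi> a (inv (f Yellow) n))))
                              (snd (snd (\<Phi> a (inv (f Blue) n)))))))
          has_sum spherical h T \<nu> f) (arrangements X)"
    by (rule has_sum_reindex_bij_betw[OF \<Phi>, THEN iffD2, OF has_sum_spherical_finitary[OF bij fixes_ge]])
  also have "(\<lambda>a. (\<Prod>n<N. coord (\<Phi> a n)) *
            (\<Prod>n<N. cnj (coef (fst (\<Phi> a (inv (f Red) n))) (fst (snd (\<Phi> a (inv (f Yellow) n))))
                              (snd (snd (\<Phi> a (inv (f Blue) n))))))) =
      (\<lambda>(i, j, k).
            (\<Prod>A\<in>black X. coef (i (bside X A Red)) (j (bside X A Yellow)) (k (bside X A Blue))) *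
            (\<Prod>B\<in>white X. cnj (coef (i (wside X B Red)) (j (wside X B Yellow)) (k (wside X B Blue)))))"
    by (intro ext) (simp only: split_paired_all prod.case black white)
  finally show ?thesis .
qed

section \<open>Numberings from group elements and from checker-boards\<close>

lemma cheburek_labeled_board:
  assumes "\<And>c. bij (g c)"
  shows "cheburek (labeled_board g) i j \<longleftrightarrow> (\<forall>c. g c i = j)"
  by (simp add: cheburek_def labeled_board_def)
    (metis assms bij_inv_eq_iff)

text \<open>A finite set and the segment of the same size have infinite complements, which are
  matched by enumerating both.\<close>

lemma ex_bij_initial_segment:
  fixes S :: "nat set"
  assumes "finite S"
  obtains r where "bij r" and "r ` S = {..<card S}"
proof -
  obtain p where p: "bij_betw p S {..<card S}"
    using finite_same_card_bij[OF assms, of "{..<card S}"] by auto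
  have inf: "infinite (- S)" "infinite (- {..<card S})"
    using assms by (simp_all only: finite_compl finite_lessThan infinite_UNIV_nat not_False_eq_True)
  define q where "q = from_nat_into (- {..<card S}) \<circ> to_nat_on (- S)"
  have q: "bij_betw q (- S) (- {..<card S})"
    unfolding q_def using inf
    by (intro bij_betw_trans[OF to_nat_on_infinite bij_betw_from_nat_into]) auto
  define r where "r n = (if n \<in> S then p n else q n)" for n
  have rS: "bij_betw r S {..<card S}" and "bij_betw r (- S) (- {..<card S})"
    using p q bij_betw_cong[of S r p] bij_betw_cong[of "- S" r q] by (simp_all only: r_def) auto
  then have "bij_betw r (S \<union> - S) ({..<card S} \<union> - {..<card S})"
    by (rule bij_betw_combine) blast
  then have "bij r"
    unfolding Compl_partition .
  then show ?thesis
    using bij_betw_imp_surj_on[OF rS] by (rule that)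
qed

text \<open>
  The set \<open>S\<close> in the proof consists of the positions that are moved by the normalized triple
  \<open>g c \<circ> inv (g Red)\<close>; it is also the set of white triangles outside chebureks.
\<close>

lemma numbering_of_has_checkerboard:
  assumes g: "g \<in> GG" and iso: "has_checkerboard g X"
  obtains N r s b w where "bij r" and "bij s" and "numbering N (\<lambda>c. r \<circ> g c \<circ> s) b w X"
proof -
  have bij: "bij (g c)" for c
    using g by (simp add: GG_def)
  note [simp] = bij_is_inj[OF bij] bij_is_surj[OF bij] inv_f_f surj_f_inv_f
  let ?Y = "delete_chebureks (labeled_board g)"
  define S where "S = {m. \<exists>c. g c (inv (g Red) m) \<noteq> m}"
  have white_Y: "white ?Y = S"
  proof -
    have "(\<exists>i. \<forall>c. g c i = j) \<longleftrightarrow> (\<forall>c. g c (inv (g Red) j) = j)" for j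
      by (metis bij bij_inv_eq_iff)
    then show ?thesis
      by (simp add: delete_chebureks_def cheburek_labeled_board[OF bij] S_def)
        (simp add: labeled_board_def)
  qed
  have black_Y: "black ?Y = inv (g Red) ` S"
  proof -
    \<comment> \<open>The triangle with number \<open>i\<close> lies in a cheburek exactly if all
      \<open>g c i\<close> agree, which can be tested against red.\<close>
    have "black ?Y = {i. \<exists>c. g c i \<noteq> g Red i}"
      by (simp add: delete_chebureks_def cheburek_labeled_board[OF bij])
        (simp add: labeled_board_def, metis)
    also have "\<dots> = inv (g Red) ` S"
    proof (intro set_eqI iffI)
      fix i assume "i \<in> {i. \<exists>c. g c i \<noteq> g Red i}"
      then have "g Red i \<in> S"
        by (simp add: S_def)
      then show "i \<in> inv (g Red) ` S"
        by (rule image_eqI[rotated]) simp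
    qed (auto simp: S_def)
    finally show ?thesis .
  qed
  have "S = (\<Union>c\<in>{Red, Yellow, Blue}. {m. (g c \<circ> inv (g Red)) m \<noteq> m})"
  proof -
    have "(\<exists>c. P c) \<longleftrightarrow> P Red \<or> P Yellow \<or> P Blue" for P
      by (metis color.exhaust)
    then show ?thesis
      by (auto simp: S_def)
  qed
  moreover have "finite {m. (g c \<circ> inv (g Red)) m \<noteq> m}" for c
    using g by (simp add: GG_def Sym_fin_def)
  ultimately have "finite S"
    by simp
  then obtain r where r: "bij r" and rS: "r ` S = {..<card S}"
    by (rule ex_bij_initial_segment)
  define N where "N = card S"
  \<comment> \<open>With this choice \<open>f c\<close> is the conjugate by \<open>r\<close> of
    \<open>g c \<circ> inv (g Red)\<close>; in particular \<open>f Red\<close> is the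
    identity.\<close>
  define s where "s = inv (g Red) \<circ> inv r"
  define f where "f c = r \<circ> g c \<circ> s" for c
  have s: "bij s"
    unfolding s_def using r bij by (intro bij_comp bij_imp_bij_inv)
  have f: "bij (f c)" for c
    unfolding f_def using r bij s by (intro bij_comp)
  have inv_r: "bij_betw (inv r) {..<N} S"
    using r rS by (metis N_def bij_betw_inv_into_subset subset_UNIV)
  have fixes_ge: "f c n = n" if "n \<ge> N" for c n
  proof -
    have "inv r n \<notin> S"
      using rS that r by (metis N_def bij_inv_eq_iff image_eqI leD lessThan_iff)
    then show ?thesis
      using r by (simp add: f_def s_def S_def bij_is_surj surj_f_inv_f)
  qed
  have sS: "bij_betw s {..<N} (inv (g Red) ` S)"
    unfolding s_def
    by (rule bij_betw_trans[OF inv_r]) (rule bij_betw_subset[OF bij_imp_bij_inv[OF bij] subset_UNIV refl])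
  \<comment> \<open>This is the number of the black triangle glued along color \<open>c\<close> to
    the white triangle \<open>inv r n\<close> in the surface of \<open>g\<close>.\<close>
  have s_inv: "s (inv (f c) n) = inv (g c) (inv r n)" for c n
  proof -
    have "r (g c (s (inv (f c) n))) = n"
      using surj_f_inv_f[OF bij_is_surj[OF f[of c]], of n] by (simp add: f_def)
    then show ?thesis
      using r bij by (metis bij_inv_eq_iff)
  qed
  obtain \<beta> \<omega> \<epsilon> where \<beta>: "bij_betw \<beta> (black ?Y) (black X)" and \<omega>: "bij_betw \<omega> (white ?Y) (white X)"
    and bs: "\<And>A c. A \<in> black ?Y \<Longrightarrow> bside X (\<beta> A) c = \<epsilon> (bside ?Y A c)"
    and ws: "\<And>B c. B \<in> white ?Y \<Longrightarrow> wside X (\<omega> B) c = \<epsilon> (wside ?Y B c)"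
    using iso unfolding has_checkerboard_def board_iso_def by blast
  have "wside X (\<omega> (inv r n)) c = bside X (\<beta> (s (inv (f c) n))) c" if "n < N" for n c
  proof -
    have "s (inv (f c) n) \<in> black ?Y"
      using inv_less_of_fixes_ge[OF f fixes_ge that, of c] sS black_Y by (auto dest: bij_betwE)
    moreover have "inv r n \<in> white ?Y"
      using inv_r that white_Y by (auto dest: bij_betwE)
    ultimately show ?thesis
      by (simp add: bs ws s_inv) (simp add: delete_chebureks_def labeled_board_def)
  qed
  moreover have "bij_betw (\<beta> \<circ> s) {..<N} (black X)" "bij_betw (\<omega> \<circ> inv r) {..<N} (white X)"
    using bij_betw_trans[OF sS \<beta>[unfolded black_Y]] bij_betw_trans[OF inv_r \<omega>[unfolded white_Y]] .
  ultimately have "numbering N f (\<beta> \<circ> s) (\<omega> \<circ> inv r) X"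
    using f fixes_ge by (simp add: numbering_def)
  then show ?thesis
    using that[OF r s] unfolding f_def by blast
qed

text \<open>Number the black and the white triangles arbitrarily and read the gluing off as
  permutations. This provides the group element whose existence \<open>on_boards\<close>
  requires.\<close>

lemma ex_numbering:
  assumes "is_checkerboard X"
  obtains N f b w where "numbering N f b w X" and "has_checkerboard f X"
proof -
  have X: "is_board X" and fin: "finite (black X)" "finite (white X)"
    and no_cheb: "\<And>A B. \<not> cheburek X A B"
    using assms by (auto simp: is_checkerboard_def)
  have bs: "bij_betw (\<lambda>A. bside X A c) (black X) (edges_of X c)"
    and ws: "bij_betw (\<lambda>B. wside X B c) (white X) (edges_of X c)" for c
    using X by (auto simp: is_board_def)
  define N where "N = card (black X)"
  have "card (white X) = N"
    \<comment> \<open>Both kinds of triangles are in bijection with the edges of any one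
      color.\<close>
    using bij_betw_same_card[OF bs] bij_betw_same_card[OF ws] by (metis N_def)
  then obtain b w where b: "bij_betw b {..<N} (black X)" and w: "bij_betw w {..<N} (white X)"
    using fin by (metis N_def card_lessThan finite_lessThan finite_same_card_bij)
  have bsb: "bij_betw (\<lambda>n. bside X (b n) c) {..<N} (edges_of X c)"
    and wsw: "bij_betw (\<lambda>n. wside X (w n) c) {..<N} (edges_of X c)" for c
    using bij_betw_trans[OF b bs] bij_betw_trans[OF w ws] by (simp_all add: comp_def)
  \<comment> \<open>For \<open>n < N\<close> this is the number of the white triangle sharing the
    edge of color \<open>c\<close> with \<open>b n\<close>; all later positions are fixed and will
    become chebureks.\<close>
  define f where "f c n = (if n < N then inv_into {..<N} (\<lambda>m. wside X (w m) c) (bside X (b n) c) else n)"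
    for c n
  have f_less: "bij_betw (f c) {..<N} {..<N}" for c
    using bij_betw_trans[OF bsb[of c] bij_betw_inv_into[OF wsw[of c]]]
    by (subst bij_betw_cong[of _ _ "inv_into {..<N} (\<lambda>m. wside X (w m) c) \<circ> (\<lambda>n. bside X (b n) c)"])
      (simp_all add: f_def)
  have f_bij: "bij (f c)" for c
  proof -
    have "bij_betw (f c) (- {..<N}) (- {..<N})"
      by (subst bij_betw_cong[of _ _ id]) (simp_all add: f_def)
    then have "bij_betw (f c) ({..<N} \<union> (- {..<N})) ({..<N} \<union> (- {..<N}))"
      by (intro bij_betw_combine f_less) auto
    then show ?thesis
      unfolding Compl_partition .
  qed
  have glue: "wside X (w (f c n)) c = bside X (b n) c" if "n < N" for c n
    using that bij_betw_inv_into_right[OF wsw[of c], of "bside X (b n) c"] bsb[of c]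
    by (auto simp: f_def dest: bij_betwE)
  have glue_inv: "wside X (w n) c = bside X (b (inv (f c) n)) c" if "n < N" for c n
  proof -
    have "inv (f c) n < N"
      by (rule inv_less_of_fixes_ge[OF f_bij _ that]) (simp add: f_def)
    from glue[OF this, of c] show ?thesis
      by (simp add: f_bij bij_is_surj surj_f_inv_f)
  qed
  have num: "numbering N f b w X"
    using b w f_bij glue_inv by (simp add: numbering_def f_def)
  let ?L = "labeled_board f"
  \<comment> \<open>A cheburek below \<open>N\<close> would be one of \<open>X\<close>, which has
    none.\<close>
  have cheb: "cheburek ?L i j \<longleftrightarrow> N \<le> i \<and> i = j" for i j
  proof
    assume "cheburek ?L i j"
    then have eq: "\<And>c. f c i = j"
      by (simp add: cheburek_labeled_board[OF f_bij])
    have "N \<le> i"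
    proof (rule ccontr)
      assume "\<not> N \<le> i"
      then have "i < N" by simp
      moreover from this have "j < N"
        using eq[of Red] f_less[of Red] by (auto dest: bij_betwE)
      ultimately have "cheburek X (b i) (w j)"
        using b w glue[of i] eq by (auto simp: cheburek_def dest: bij_betwE)
      with no_cheb show False ..
    qed
    with eq[of Red] show "N \<le> i \<and> i = j"
      by (simp add: f_def)
  qed (simp add: cheburek_labeled_board[OF f_bij], simp add: f_def)
  \<comment> \<open>The edge \<open>(c, n)\<close> of the surface of \<open>f\<close> goes to the
    side of color \<open>c\<close> of \<open>b n\<close>. The color is recovered from the image,
    whence injectivity across colors.\<close>
  define \<epsilon> where "\<epsilon> e = bside X (b (snd e)) (fst e)" for e
  have edge: "\<epsilon> (c, n) \<in> edges X \<and> edge_color X (\<epsilon> (c, n)) = c" if "n < N" for c n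
    using that bij_betwE[OF bsb[of c]] by (simp add: \<epsilon>_def edges_of_def)
  have \<epsilon>: "bij_betw \<epsilon> (UNIV \<times> {..<N}) (edges X)"
  proof (rule bij_betw_imageI)
    show "inj_on \<epsilon> (UNIV \<times> {..<N})"
    proof (rule inj_onI, clarify)
      fix c n d m
      assume n: "n < N" and m: "m < N" and eq: "\<epsilon> (c, n) = \<epsilon> (d, m)"
      have "c = d"
        using edge[OF n, of c] edge[OF m, of d] eq by simp
      with eq n m show "c = d \<and> n = m"
        using bij_betw_imp_inj_on[OF bsb[of c]] by (simp add: \<epsilon>_def inj_on_def)
    qed
    show "\<epsilon> ` (UNIV \<times> {..<N}) = edges X"
    proof (intro equalityI subsetI)
      fix e assume "e \<in> edges X"
      then have "e \<in> edges_of X (edge_color X e)"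
        by (simp add: edges_of_def)
      then obtain n where "n < N" "e = bside X (b n) (edge_color X e)"
        using bij_betw_imp_surj_on[OF bsb] by (metis (no_types, lifting) imageE lessThan_iff)
      then show "e \<in> \<epsilon> ` (UNIV \<times> {..<N})"
        by (intro image_eqI[of _ _ "(edge_color X e, n)"]) (simp_all add: \<epsilon>_def)
    qed (use edge in auto)
  qed
  have L: "black (delete_chebureks ?L) = {..<N}" "white (delete_chebureks ?L) = {..<N}"
    "edges (delete_chebureks ?L) = UNIV \<times> {..<N}"
    "edge_color (delete_chebureks ?L) = fst" "bside (delete_chebureks ?L) = (\<lambda>i c. (c, i))"
    "wside (delete_chebureks ?L) = (\<lambda>j c. (c, inv (f c) j))"
    by (simp_all add: delete_chebureks_def cheb) (auto simp: labeled_board_def not_le[symmetric])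
  have "board_iso (delete_chebureks ?L) X"
    unfolding board_iso_def L
    using b w \<epsilon> edge glue_inv
    by (intro exI[of _ b] exI[of _ w] exI[of _ \<epsilon>]) (auto simp: \<epsilon>_def)
  then show ?thesis
    using that[OF num] by (simp add: has_checkerboard_def)
qed

theorem proposition4p2:
  fixes u :: "'i \<Rightarrow> 'u :: complex_hilbert_space"
    and v :: "'j \<Rightarrow> 'v :: complex_hilbert_space"
    and w :: "'k \<Rightarrow> 'w :: complex_hilbert_space"
    and tens :: "'u \<Rightarrow> 'v \<Rightarrow> 'w \<Rightarrow> 'h :: complex_hilbert_space"
    and h :: 'h
    and coef :: "'i \<Rightarrow> 'j \<Rightarrow> 'k \<Rightarrow> complex"
    and T :: "(nat \<Rightarrow> 'h) \<Rightarrow> 'H :: complex_hilbert_space"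
    and \<nu> :: "(color \<Rightarrow> nat \<Rightarrow> nat) \<Rightarrow> 'H \<Rightarrow> 'H"
    and \<aa> :: "('b, 'c, 'e) board"
  assumes "orthonormal_basis u" and "orthonormal_basis v" and "orthonormal_basis w"
    and "hilbert_tensor tens"
    and "((\<lambda>(i, j, k). coef i j k *\<^sub>C tens (u i) (v j) (w k)) has_sum h) UNIV"
    and "norm h = 1"
    and "infinite_tensor h T"
    and "tensor_representation tens h T \<nu>"
    and "is_checkerboard \<aa>"
  shows "((\<lambda>(i, j, k).
            (\<Prod>A\<in>black \<aa>. coef (i (bside \<aa> A Red)) (j (bside \<aa> A Yellow)) (k (bside \<aa> A Blue))) *
            (\<Prod>B\<in>white \<aa>. cnj (coef (i (wside \<aa> B Red)) (j (wside \<aa> B Yellow)) (k (wside \<aa> B Blue)))))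
          has_sum on_boards (spherical h T \<nu>) \<aa>) (arrangements \<aa>)"
proof -
  interpret tensor_model u v w tens h coef T \<nu>
    using assms(1-8) by unfold_locales
  let ?term = "\<lambda>(i, j, k).
            (\<Prod>A\<in>black \<aa>. coef (i (bside \<aa> A Red)) (j (bside \<aa> A Yellow)) (k (bside \<aa> A Blue))) *
            (\<Prod>B\<in>white \<aa>. cnj (coef (i (wside \<aa> B Red)) (j (wside \<aa> B Yellow)) (k (wside \<aa> B Blue))))"
  have board: "is_board \<aa>"
    using assms(9) by (simp add: is_checkerboard_def)
  \<comment> \<open>The summands and the index set depend on \<open>\<aa>\<close> alone, while
    \<open>g\<close> enters only through the value of the sum.\<close>
  have sum: "(?term has_sum spherical h T \<nu> g) (arrangements \<aa>)"
    if g: "g \<in> GG" and gX: "has_checkerboard g \<aa>" for g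
  proof -
    obtain N r s b wt where "bij r" "bij s" and num: "numbering N (\<lambda>c. r \<circ> g c \<circ> s) b wt \<aa>"
      using numbering_of_has_checkerboard[OF g gX] .
    then show ?thesis
      using has_sum_spherical_numbering[OF board num] spherical_biinvariant[OF g] by simp
  qed
  obtain N f b wt where num: "numbering N f b wt \<aa>" and f: "has_checkerboard f \<aa>"
    using ex_numbering[OF assms(9)] .
  have "f \<in> GG"
    using num by (auto simp: numbering_def intro: finitary_in_GG)
  \<comment> \<open>Uniqueness of sums forces all group elements with checker-board
    \<open>\<aa>\<close> to have the same value, and \<open>f\<close> is one of them, so the
    description is well defined.\<close>
  then have "on_boards (spherical h T \<nu>) \<aa> = spherical h T \<nu> f"
    unfolding on_boards_def using f sum
    by (intro the_equality) (blast intro: has_sum_unique)+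
  then show ?thesis
    using sum[OF \<open>f \<in> GG\<close> f] by simp
qed

end
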